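(* Let $\mathcal{X}$ be a finite state space with $n := |\mathcal{X}|\ge 2$, $\pi$ a probability mass function on $\mathcal{X}$ with full support, $P \in \mathcal{L}(\pi)$ and $Q \in \mathcal{I}(\pi) \cap \mathcal{L}$. Fix $\alpha \in (0,1)$ and let $\overline{P}_{\alpha}(Q) := \alpha P + (1-\alpha) QPQ$. Then: (1) $\lambda_2(\overline{P}_{\alpha}(Q)) \leq \lambda_2(P)$, where equality holds if and only if there exists a common eigenvector $f$ such that $\overline{P}_{\alpha}(Q)f = \lambda_2(\overline{P}_{\alpha}(Q))f$, $Pf = \lambda_2(P) f$ and $QPQf = \lambda_2(QPQ) f$. (2) $\lambda_n(P) \leq \lambda_n(\overline{P}_{\alpha}(Q))$, where equality holds if and only if there exists a common eigenvector $g$ such that $\overline{P}_{\alpha}(Q)g = \lambda_n(\overline{P}_{\alpha}(Q))g$, $Pg = \lambda_n(P) g$ and $QPQg = \lambda_n(QPQ) g$. Consequently, $\mathrm{SLEM}(\overline{P}_\alpha(Q)) \leq \mathrm{SLEM}(P)$. If $P$ (and hence $QPQ$) is further assumed to be positive-semi-definite (as a self-adjoint operator on $\ell^2(\pi)$), then $$ \max\{\alpha,1-\alpha\} \lambda_2(P) \leq \lambda_2(\overline{P}_{\alpha}(Q)) \leq \lambda_2(P), $$ $$ \max\{\alpha,1-\alpha\} \mathrm{SLEM}(P) \leq \mathrm{SLEM}(\overline{P}_\alpha(Q)) \leq \mathrm{SLEM}(P). $$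
   Context: $\mathcal{L}$ is the set of transition (row-stochastic) matrices on $\mathcal{X}$; $\mathcal{L}(\pi)$ is the set of $\pi$-reversible ones, i.e. $\pi(x)P(x,y)=\pi(y)P(y,x)$ for all $x,y$. For a matrix $M$, $M^*(x,y)=\frac{\pi(y)}{\pi(x)}M(y,x)$ is the $\ell^2(\pi)$-adjoint, where $\ell^2(\pi)$ has inner product $\langle f,g\rangle_\pi=\sum_x f(x)g(x)\pi(x)$. $\mathcal{I}(\pi)$ is the set of real matrices $Q$ with $Q^2=I$ and $Q^*=Q$. For an $\ell^2(\pi)$-self-adjoint matrix $M$, $\lambda_1(M)\ge\lambda_2(M)\ge\dots\ge\lambda_n(M)$ are its eigenvalues counted with multiplicity. $\mathrm{SLEM}(P):=\max\{\lambda_2(P),|\lambda_n(P)|\}$. Eigenvectors are nonzero. *)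

theory Defs
  imports "HOL-Probability.Probability" "HOL-Computational_Algebra.Polynomial"
begin

text \<open>The state space is the finite type \<open>'x\<close>, so \<open>n = CARD('x)\<close>. A matrix is an element of
  \<open>real^'x^'x\<close>, with \<open>P $ x $ y\<close> the entry usually written \<open>P(x,y)\<close>. A probability mass function
  is an element of \<open>'x pmf\<close>; full support means \<open>set_pmf \<pi> = UNIV\<close>.\<close>

definition transition_matrices :: "(real^'x^'x::finite) set" where
  "transition_matrices = {P. (\<forall>x y. 0 \<le> P $ x $ y) \<and> (\<forall>x. (\<Sum>y\<in>UNIV. P $ x $ y) = 1)}"

definition reversible_transition_matrices :: "'x::finite pmf \<Rightarrow> (real^'x^'x) set" where
  "reversible_transition_matrices \<pi> =
     {P \<in> transition_matrices. \<forall>x y. pmf \<pi> x * P $ x $ y = pmf \<pi> y * P $ y $ x}"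

definition l2_inner :: "'x::finite pmf \<Rightarrow> real^'x \<Rightarrow> real^'x \<Rightarrow> real" where
  "l2_inner \<pi> f g = (\<Sum>x\<in>UNIV. f $ x * g $ x * pmf \<pi> x)"

definition l2_adjoint :: "'x::finite pmf \<Rightarrow> real^'x^'x \<Rightarrow> real^'x^'x" where
  "l2_adjoint \<pi> M = (\<chi> x y. pmf \<pi> y / pmf \<pi> x * M $ y $ x)"

definition isometric_involutions :: "'x::finite pmf \<Rightarrow> (real^'x^'x) set" where
  "isometric_involutions \<pi> = {Q. Q ** Q = mat 1 \<and> l2_adjoint \<pi> Q = Q}"

definition l2_pos_semidef :: "'x::finite pmf \<Rightarrow> real^'x^'x \<Rightarrow> bool" where
  "l2_pos_semidef \<pi> M \<longleftrightarrow> l2_adjoint \<pi> M = M \<and> (\<forall>f. 0 \<le> l2_inner \<pi> (M *v f) f)"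

text \<open>The characteristic polynomial \<open>det (X I - M)\<close>, as a determinant over the ring \<open>real poly\<close>.\<close>

definition charpoly :: "real^'x^'x::finite \<Rightarrow> real poly" where
  "charpoly M = det (mat [:0, 1:] - (\<chi> x y. [:M $ x $ y:]))"

text \<open>The real eigenvalues in non-increasing order, each repeated according to its multiplicity
  as a root of the characteristic polynomial. If \<open>M\<close> is self-adjoint with respect to
  \<open>l2_inner \<pi>\<close> for a \<open>\<pi>\<close> of full support, then it is diagonalisable over the reals,
  so the list has length \<open>CARD('x)\<close> and the multiplicities are also the dimensions
  of the eigenspaces.\<close>

definition eigvals :: "real^'x^'x::finite \<Rightarrow> real list" where
  "eigvals M = rev (sorted_list_of_multiset (proots (charpoly M)))"

text \<open>\<open>eigval k M\<close> is the \<open>k\<close>-th largest eigenvalue, with \<open>k\<close> counted from \<open>1\<close>; the list access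
  is meaningful for \<open>1 \<le> k \<le> CARD('x)\<close> and \<open>M\<close> self-adjoint as above.\<close>

definition eigval :: "nat \<Rightarrow> real^'x^'x::finite \<Rightarrow> real" where
  "eigval k M = eigvals M ! (k - 1)"

definition SLEM :: "real^'x^'x::finite \<Rightarrow> real" where
  "SLEM M = max (eigval 2 M) \<bar>eigval CARD('x) M\<bar>"

definition eigenvector :: "real^'x^'x::finite \<Rightarrow> real \<Rightarrow> real^'x \<Rightarrow> bool" where
  "eigenvector M c f \<longleftrightarrow> f \<noteq> 0 \<and> M *v f = c *\<^sub>R f"

definition P_bar :: "real \<Rightarrow> real^'x^'x::finite \<Rightarrow> real^'x^'x \<Rightarrow> real^'x^'x" where
  "P_bar \<alpha> P Q = \<alpha> *\<^sub>R P + (1 - \<alpha>) *\<^sub>R (Q ** P ** Q)"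

end

theory Submission
  imports Defs
begin

text \<open>The constant function is a common top eigenvector of \<open>P\<close>, \<open>QPQ\<close> and their convex
  combination, so by the spectral theorem \<open>\<lambda>\<^sub>2\<close> is the maximum of the Rayleigh quotient over its
  orthogonal complement, and \<open>\<lambda>\<^sub>n\<close> is the minimum over all nonzero functions. The Rayleigh quotient
  is linear in the matrix, and \<open>QPQ\<close> is similar to \<open>P\<close>, hence has the same extremal values. A
  function attaining an extremal value for the convex combination attains it for both summands, and
  then it is an eigenvector of each. For positive semidefinite \<open>P\<close> one summand may be dropped,
  which gives the lower bounds.\<close>

section \<open>Spectral theorem for symmetric operators\<close>

text \<open>A zero of a nonnegative form is a minimum. Moving from \<open>v\<close> along
  \<open>- R v\<close> changes the form to first order by
  \<open>- 2 * t * (R v \<bullet> R v)\<close>, which would make it negative unless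
  \<open>R v = 0\<close>.\<close>

lemma psd_form_zero:
  fixes R :: "'a::real_inner \<Rightarrow> 'a"
  assumes "linear R" "subspace S" "\<And>x. x \<in> S \<Longrightarrow> R x \<in> S"
    and sym: "\<And>x y. R x \<bullet> y = x \<bullet> R y"
    and nonneg: "\<And>x. x \<in> S \<Longrightarrow> 0 \<le> R x \<bullet> x"
    and v: "v \<in> S" "R v \<bullet> v = 0"
  shows "R v = 0"
proof -
  \<comment> \<open>The form at \<open>v - t *\<^sub>R R v\<close> is
    \<open>t\<^sup>2 * b - 2 * t * a\<close>. For \<open>b > 0\<close> its minimiser is
    \<open>a / b\<close>; the denominator \<open>b + 1\<close> also covers \<open>b = 0\<close> and
    still gives a negative value unless \<open>a = 0\<close>.\<close>
  define a b t where "a = R v \<bullet> R v" and "b = R (R v) \<bullet> R v" and "t = a / (b + 1)"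
  have "b \<ge> 0"
    unfolding b_def using assms by blast
  have "v - t *\<^sub>R R v \<in> S"
    using assms by (intro subspace_diff subspace_scale) auto
  then have "0 \<le> R (v - t *\<^sub>R R v) \<bullet> (v - t *\<^sub>R R v)"
    by (rule nonneg)
  also have "\<dots> = t\<^sup>2 * b - 2 * t * a"
    using v(2) sym[of "R v" v]
    by (simp add: linear_diff[OF \<open>linear R\<close>] linear_scale[OF \<open>linear R\<close>] inner_diff_left
        inner_diff_right a_def b_def inner_commute power2_eq_square algebra_simps)
  finally have "0 \<le> (b + 1)\<^sup>2 * (t\<^sup>2 * b - 2 * t * a)"
    by simp
  also have "\<dots> = (t * (b + 1))\<^sup>2 * b - 2 * (t * (b + 1)) * (b + 1) * a"
    by (simp add: power2_eq_square algebra_simps)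
  also have "t * (b + 1) = a"
    using \<open>b \<ge> 0\<close> by (simp add: t_def)
  also have "a\<^sup>2 * b - 2 * a * (b + 1) * a = - (a\<^sup>2 * (b + 2))"
    by (simp add: power2_eq_square algebra_simps)
  finally have "a\<^sup>2 * (b + 2) \<le> 0"
    by simp
  with \<open>b \<ge> 0\<close> have "a = 0"
    by (metis add_nonneg_pos mult_le_0_iff not_less power2_eq_square power_eq_0_iff
        zero_le_square zero_less_numeral order_antisym)
  then show ?thesis
    by (simp add: a_def)
qed

text \<open>The Rayleigh quotient attains a maximum \<open>c\<close> at some \<open>v\<close> on the
  compact unit sphere of \<open>S\<close>. Then the form of \<open>c - T\<close> is nonnegative on
  \<open>S\<close> and zero at \<open>v\<close>, so \<open>psd_form_zero\<close> applies.\<close>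

lemma symmetric_eigenvector_exists:
  fixes T :: "'a::euclidean_space \<Rightarrow> 'a"
  assumes T: "linear T" and S: "subspace S" and inv: "\<And>x. x \<in> S \<Longrightarrow> T x \<in> S"
    and sym: "\<And>x y. T x \<bullet> y = x \<bullet> T y" and "S \<noteq> {0}"
  obtains v c where "v \<in> S" "norm v = 1" "T v = c *\<^sub>R v"
proof -
  define K where "K = S \<inter> sphere 0 1"
  have "compact K"
    unfolding K_def using S by (intro closed_Int_compact closed_subspace) auto
  moreover have "K \<noteq> {}"
  proof -
    obtain x where "x \<in> S" "x \<noteq> 0"
      using \<open>S \<noteq> {0}\<close> subspace_0[OF S] by blast
    then have "x /\<^sub>R norm x \<in> K"
      using S by (simp add: K_def subspace_scale)
    then show ?thesis by blast
  qed
  moreover have "continuous_on K (\<lambda>x. T x \<bullet> x)"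
    using T by (intro continuous_intros linear_continuous_on linear_conv_bounded_linear[THEN iffD1])
  ultimately obtain v where v: "v \<in> K" "\<And>x. x \<in> K \<Longrightarrow> T x \<bullet> x \<le> T v \<bullet> v"
    using continuous_attains_sup[of K "\<lambda>x. T x \<bullet> x"] by blast
  define c where "c = T v \<bullet> v"
  have vv: "v \<in> S" "norm v = 1" "v \<bullet> v = 1"
    using v by (auto simp: K_def norm_eq_1)
  have le: "T x \<bullet> x \<le> c * (x \<bullet> x)" if "x \<in> S" for x
  proof (cases "x = 0")
    case False
    have "T (x /\<^sub>R norm x) \<bullet> (x /\<^sub>R norm x) \<le> c"
      unfolding c_def using that S False by (intro v) (simp add: K_def subspace_scale)
    then have "(T x \<bullet> x) / (norm x)\<^sup>2 \<le> c"
      by (simp add: linear_scale[OF T] power2_eq_square field_simps)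
    then show ?thesis
      using False by (simp add: divide_le_eq power2_norm_eq_inner)
  qed (simp add: linear_0[OF T])
  have "c *\<^sub>R v - T v = 0"
  proof (rule psd_form_zero[where R = "\<lambda>x. c *\<^sub>R x - T x" and S = S])
    show "linear (\<lambda>x. c *\<^sub>R x - T x)"
      using T by (intro linear_compose_sub linear_scale_self)
    show "0 \<le> (c *\<^sub>R x - T x) \<bullet> x" if "x \<in> S" for x
      using le[OF that] by (simp add: inner_diff_left)
  qed (use S inv sym vv in \<open>auto simp: inner_diff_left inner_diff_right c_def intro: subspace_diff subspace_scale\<close>)
  then show ?thesis
    using that[of v c] vv by simp
qed

text \<open>Induction on the dimension: by symmetry, the part of \<open>S\<close> orthogonal to a
  unit eigenvector is again invariant.\<close>

lemma symmetric_orthonormal_eigenbasis: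
  fixes T :: "'a::euclidean_space \<Rightarrow> 'a"
  assumes T: "linear T" and S: "subspace S" and inv: "\<And>x. x \<in> S \<Longrightarrow> T x \<in> S"
    and sym: "\<And>x y. T x \<bullet> y = x \<bullet> T y"
  shows "\<exists>B. B \<subseteq> S \<and> pairwise orthogonal B \<and> (\<forall>b\<in>B. norm b = 1 \<and> (\<exists>c. T b = c *\<^sub>R b)) \<and> S = span B"
  using S inv
proof (induction "dim S" arbitrary: S rule: less_induct)
  case less
  show ?case
  proof (cases "S = {0}")
    case True
    then show ?thesis by (intro exI[of _ "{}"]) auto
  next
    case False
    then obtain v c where v: "v \<in> S" "norm v = 1" "T v = c *\<^sub>R v"
      using symmetric_eigenvector_exists[OF T less.prems sym] by blast
    define S' where "S' = {x \<in> S. x \<bullet> v = 0}"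
    have S': "subspace S'"
      using less.prems(1) by (auto simp: S'_def subspace_def inner_add_left)
    moreover have "T x \<in> S'" if "x \<in> S'" for x
      using that less.prems(2) by (simp add: S'_def sym v)
    moreover have "dim S' < dim S"
    proof -
      have "v \<notin> S'"
        using v by (auto simp: S'_def)
      then have "S' \<subset> S"
        using v(1) S'_def by blast
      then show ?thesis
        using S' less.prems(1) by (metis dim_psubset span_eq_iff)
    qed
    ultimately obtain B where B: "B \<subseteq> S'" "pairwise orthogonal B"
        "\<forall>b\<in>B. norm b = 1 \<and> (\<exists>c. T b = c *\<^sub>R b)" "S' = span B"
      using less.hyps by blast
    have "S = span (insert v B)"
    proof
      show "span (insert v B) \<subseteq> S"
        using B v less.prems(1) by (intro span_minimal) (auto simp: S'_def)
      show "S \<subseteq> span (insert v B)"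
      proof
        fix x assume "x \<in> S"
        then have "x - (x \<bullet> v) *\<^sub>R v \<in> S'"
          using v less.prems(1)
          by (auto simp: S'_def inner_diff_left norm_eq_1 intro!: subspace_diff subspace_scale)
        then show "x \<in> span (insert v B)"
          using B(4) span_breakdown_eq by blast
      qed
    qed
    moreover have "pairwise orthogonal (insert v B)"
      using B(1,2) by (auto simp: pairwise_insert orthogonal_def S'_def inner_commute)
    ultimately show ?thesis
      using B v by (intro exI[of _ "insert v B"]) (auto simp: S'_def)
  qed
qed

text \<open>Splitting off a prescribed unit eigenvector \<open>u\<close> works because its orthogonal complement is
  again invariant.\<close>

lemma symmetric_orthonormal_eigenbasis_containing:
  fixes T :: "'a::euclidean_space \<Rightarrow> 'a"
  assumes T: "linear T" and sym: "\<And>x y. T x \<bullet> y = x \<bullet> T y"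
    and u: "norm u = 1" "T u = a *\<^sub>R u"
  obtains B where "u \<in> B" "pairwise orthogonal B" "finite B" "card B = DIM('a)"
    "\<And>b. b \<in> B \<Longrightarrow> norm b = 1 \<and> (\<exists>c. T b = c *\<^sub>R b)"
proof -
  define S where "S = {x. x \<bullet> u = 0}"
  have "subspace S"
    by (auto simp: S_def subspace_def inner_add_left)
  moreover have "T x \<in> S" if "x \<in> S" for x
    using that by (simp add: S_def sym u)
  ultimately obtain B where B: "B \<subseteq> S" "pairwise orthogonal B"
      "\<forall>b\<in>B. norm b = 1 \<and> (\<exists>c. T b = c *\<^sub>R b)" "S = span B"
    using symmetric_orthonormal_eigenbasis[OF T _ _ sym] by blast
  have "x \<in> span (insert u B)" for x
  proof -
    have "x - (x \<bullet> u) *\<^sub>R u \<in> S"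
      using u by (simp add: S_def inner_diff_left norm_eq_1)
    then show ?thesis
      using B(4) span_breakdown_eq by blast
  qed
  then have span: "span (insert u B) = UNIV" by blast
  have orth: "pairwise orthogonal (insert u B)"
    using B(1,2) by (auto simp: pairwise_insert orthogonal_def S_def inner_commute)
  moreover have "0 \<notin> insert u B"
    using u B(3) by force
  ultimately have ind: "independent (insert u B)"
    by (rule pairwise_orthogonal_independent)
  then have "card (insert u B) = DIM('a)"
    using span by (metis dim_UNIV dim_span_eq_card_independent)
  moreover have "finite (insert u B)"
    using ind by (rule independent_imp_finite)
  ultimately show ?thesis
    using orth B(3) u by (intro that[of "insert u B"]) blast+
qed

section \<open>Reversibility, similarity and eigenvalue lists\<close>

text \<open>Detailed balance divided by the positive weight \<open>pmf \<pi> x\<close> is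
  self-adjointness, entry by entry.\<close>

lemma reversible_transition_matrices_iff:
  assumes "set_pmf \<pi> = UNIV"
  shows "M \<in> reversible_transition_matrices \<pi> \<longleftrightarrow> M \<in> transition_matrices \<and> l2_adjoint \<pi> M = M"
proof -
  have "pmf \<pi> x > 0" for x
    using assms by (simp add: pmf_positive)
  then show ?thesis
    by (auto simp: reversible_transition_matrices_def l2_adjoint_def vec_eq_iff field_simps
        less_imp_neq[THEN not_sym])
qed

text \<open>Similarity as an intertwining relation avoids inverses: after lifting to
  \<open>real poly\<close>, determinants multiply and the nonzero factor coming from
  \<open>E\<close> cancels.\<close>

lemma charpoly_similar:
  fixes M N E :: "real^'x^'x::finite"
  assumes "M ** E = E ** N" "det E \<noteq> 0"
  shows "charpoly M = charpoly N"
proof -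
  define C :: "real^'x^'x \<Rightarrow> real poly^'x^'x" where "C A = (\<chi> x y. [:A $ x $ y:])" for A
  have C_mult: "C (A ** B) = C A ** C B" for A B
    by (simp add: C_def matrix_matrix_mult_def vec_eq_iff sum_to_poly mult.commute)
  have diff: "(A - B) ** G = A ** G - B ** G" "G ** (A - B) = G ** A - G ** B"
    for A B G :: "real poly^'x^'x"
    by (simp_all add: matrix_matrix_mult_def vec_eq_iff sum_subtractf algebra_simps)
  have X: "mat [:0, 1:] ** A = A ** mat [:0, 1:]" for A :: "real poly^'x^'x"
    by (simp add: matrix_matrix_mult_def mat_def vec_eq_iff if_distrib if_distribR sum.delta'
        mult.commute cong: if_cong)
  have "(mat [:0, 1:] - C M) ** C E = C E ** (mat [:0, 1:] - C N)"
    by (simp add: diff X C_mult[symmetric] assms)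
  then have "charpoly M * det (C E) = det (C E) * charpoly N"
    unfolding charpoly_def C_def[symmetric] by (metis det_mul)
  \<comment> \<open>The entries of \<open>C E\<close> are constant polynomials, so evaluation
    recovers \<open>det E\<close>.\<close>
  moreover have "poly (det (C E)) 0 = det E"
    by (simp add: det_def C_def poly_sum poly_prod)
  then have "det (C E) \<noteq> 0"
    using assms(2) by auto
  ultimately show ?thesis
    by (simp add: mult.commute)
qed

lemma eigval_similar:
  fixes M N E :: "real^'x^'x::finite"
  assumes "M ** E = E ** N" "det E \<noteq> 0"
  shows "eigval k M = eigval k N"
  using charpoly_similar[OF assms] by (simp add: eigval_def eigvals_def)

lemma proots_charpoly_diagonal:
  fixes d :: "'x::finite \<Rightarrow> real"
  shows "proots (charpoly (\<chi> i j. if i = j then d i else 0)) = image_mset d (mset_set UNIV)"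
proof -
  have "charpoly (\<chi> i j. if i = j then d i else 0) = (\<Prod>i\<in>UNIV. [:- d i, 1:])"
    unfolding charpoly_def by (subst det_diagonal) (auto simp: mat_def)
  then show ?thesis
    by (simp add: proots_prod sum_unfold_sum_mset)
qed


lemma last_sorted_list_of_multiset:
  assumes "M \<noteq> {#}"
  shows "last (sorted_list_of_multiset M) = Max (set_mset M)"
proof (rule Max_eqI[symmetric])
  have ne: "sorted_list_of_multiset M \<noteq> []"
    using assms by (metis mset.simps(1) mset_sorted_list_of_multiset)
  then show "last (sorted_list_of_multiset M) \<in> set_mset M"
    by (metis last_in_set set_sorted_list_of_multiset)
  fix x assume "x \<in> set_mset M"
  then obtain i where "i < length (sorted_list_of_multiset M)" "x = sorted_list_of_multiset M ! i"
    by (metis in_set_conv_nth set_sorted_list_of_multiset)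
  then show "x \<le> last (sorted_list_of_multiset M)"
    using ne by (simp add: last_conv_nth sorted_nth_mono)
qed simp

lemma hd_sorted_list_of_multiset:
  assumes "M \<noteq> {#}"
  shows "hd (sorted_list_of_multiset M) = Min (set_mset M)"
proof (rule Min_eqI[symmetric])
  have ne: "sorted_list_of_multiset M \<noteq> []"
    using assms by (metis mset.simps(1) mset_sorted_list_of_multiset)
  then show "hd (sorted_list_of_multiset M) \<in> set_mset M"
    by (metis hd_in_set set_sorted_list_of_multiset)
  fix x assume "x \<in> set_mset M"
  then obtain i where "i < length (sorted_list_of_multiset M)" "x = sorted_list_of_multiset M ! i"
    by (metis in_set_conv_nth set_sorted_list_of_multiset)
  then show "hd (sorted_list_of_multiset M) \<le> x"
    using ne by (simp add: hd_conv_nth sorted_nth_mono)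
qed simp

section \<open>The weighted inner product\<close>

lemma l2_inner_add_left: "l2_inner \<pi> (f + g) h = l2_inner \<pi> f h + l2_inner \<pi> g h"
  by (simp add: l2_inner_def sum.distrib algebra_simps)

lemma l2_inner_scaleR_left: "l2_inner \<pi> (c *\<^sub>R f) h = c * l2_inner \<pi> f h"
  by (simp add: l2_inner_def sum_distrib_left algebra_simps)

lemma l2_inner_commute: "l2_inner \<pi> f g = l2_inner \<pi> g f"
  by (simp add: l2_inner_def mult.commute)

lemma l2_inner_sum_left: "l2_inner \<pi> (\<Sum>i\<in>I. f i) g = (\<Sum>i\<in>I. l2_inner \<pi> (f i) g)"
proof -
  have "l2_inner \<pi> 0 g = 0"
    by (simp add: l2_inner_def)
  then show ?thesis
    by (induction I rule: infinite_finite_induct) (simp_all add: l2_inner_add_left)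
qed

lemma l2_inner_pos:
  assumes "set_pmf \<pi> = UNIV" "f \<noteq> 0"
  shows "0 < l2_inner \<pi> f f"
proof -
  obtain x where "f $ x \<noteq> 0"
    using assms(2) by (auto simp: vec_eq_iff)
  moreover have "pmf \<pi> x > 0"
    using assms(1) by (simp add: pmf_positive)
  ultimately have "0 < f $ x * f $ x * pmf \<pi> x"
    by (auto simp: zero_less_mult_iff)
  then show ?thesis
    unfolding l2_inner_def by (intro sum_pos2[of _ x]) auto
qed

text \<open>The ratio in \<open>l2_adjoint\<close> trades the weight at \<open>x\<close> for the
  weight at \<open>y\<close>; swapping the sums does the rest.\<close>

lemma l2_inner_adjoint:
  assumes "set_pmf \<pi> = UNIV"
  shows "l2_inner \<pi> (l2_adjoint \<pi> M *v f) g = l2_inner \<pi> f (M *v g)"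
proof -
  have "pmf \<pi> x \<noteq> 0" for x
    using assms by (simp add: set_pmf_iff[symmetric])
  then have "l2_inner \<pi> (l2_adjoint \<pi> M *v f) g =
      (\<Sum>x\<in>UNIV. \<Sum>y\<in>UNIV. pmf \<pi> y * M $ y $ x * f $ y * g $ x)"
    by (simp add: l2_inner_def l2_adjoint_def matrix_vector_mult_def sum_distrib_left sum_distrib_right
        field_simps)
  also have "\<dots> = l2_inner \<pi> f (M *v g)"
    by (subst sum.swap)
       (simp add: l2_inner_def matrix_vector_mult_def sum_distrib_left sum_distrib_right mult_ac)
  finally show ?thesis .
qed

section \<open>Ordered eigenvalues from an orthonormal eigenbasis\<close>

text \<open>Indexing the basis by the states makes the change of basis a square matrix over
  \<open>'x\<close>.\<close>

locale orthonormal_eigenbasis =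
  fixes \<pi> :: "'x::finite pmf" and M :: "real^'x^'x" and e :: "'x \<Rightarrow> real^'x" and d :: "'x \<Rightarrow> real"
  assumes orthonormal: "l2_inner \<pi> (e i) (e j) = (if i = j then 1 else 0)"
    and eigen: "M *v e i = d i *\<^sub>R e i"
begin

definition basis_matrix :: "real^'x^'x" where
  "basis_matrix = (\<chi> i j. e j $ i)"

text \<open>Row \<open>i\<close> applied to \<open>f\<close> gives the Fourier coefficient
  \<open>l2_inner \<pi> f (e i)\<close>.\<close>

definition coord_matrix :: "real^'x^'x" where
  "coord_matrix = (\<chi> i j. e i $ j * pmf \<pi> j)"

lemma coord_basis: "coord_matrix ** basis_matrix = mat 1"
  using orthonormal
  by (simp add: coord_matrix_def basis_matrix_def matrix_matrix_mult_def mat_def vec_eq_iff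
      l2_inner_def mult_ac)

text \<open>This is completeness of the orthonormal system: a left inverse of a square matrix is a
  right inverse.\<close>

lemma basis_coord: "basis_matrix ** coord_matrix = mat 1"
  using coord_basis matrix_left_right_inverse by blast

lemma expansion: "f = (\<Sum>i\<in>UNIV. l2_inner \<pi> f (e i) *\<^sub>R e i)"
proof -
  have "f = basis_matrix *v (coord_matrix *v f)"
    by (simp add: matrix_vector_mul_assoc basis_coord)
  also have "\<dots> = (\<Sum>i\<in>UNIV. l2_inner \<pi> f (e i) *\<^sub>R e i)"
    by (simp add: vec_eq_iff basis_matrix_def coord_matrix_def matrix_vector_mult_def l2_inner_def mult_ac)
  finally show ?thesis .
qed

lemma mult_expansion: "M *v f = (\<Sum>i\<in>UNIV. (d i * l2_inner \<pi> f (e i)) *\<^sub>R e i)"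
  by (subst (1) expansion[of f])
     (simp add: linear_sum[OF matrix_vector_mul_linear] linear_scale[OF matrix_vector_mul_linear] eigen mult.commute)

text \<open>The shifted form is diagonal in coordinates, so the signs of \<open>c - d i\<close>
  yield Rayleigh bounds, with equality only if every term vanishes.\<close>

lemma quadratic_form_shift:
  "c * l2_inner \<pi> f f - l2_inner \<pi> (M *v f) f = (\<Sum>i\<in>UNIV. (c - d i) * (l2_inner \<pi> f (e i))\<^sup>2)"
proof -
  have "l2_inner \<pi> (M *v f) f = (\<Sum>i\<in>UNIV. d i * (l2_inner \<pi> f (e i))\<^sup>2)"
    by (simp add: mult_expansion l2_inner_sum_left l2_inner_scaleR_left power2_eq_square
        l2_inner_commute[of _ "e _" f] mult.assoc)
  moreover have "l2_inner \<pi> f f = (\<Sum>i\<in>UNIV. (l2_inner \<pi> f (e i))\<^sup>2)"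
    by (subst (1) expansion[of f])
       (simp add: l2_inner_sum_left l2_inner_scaleR_left power2_eq_square l2_inner_commute[of _ "e _" f])
  ultimately show ?thesis
    by (simp add: sum_distrib_left sum_subtractf algebra_simps)
qed

lemma eigenvectorI_coords:
  assumes "\<And>i. (c - d i) * (l2_inner \<pi> f (e i))\<^sup>2 = 0"
  shows "M *v f = c *\<^sub>R f"
proof -
  have "d i * l2_inner \<pi> f (e i) = c * l2_inner \<pi> f (e i)" for i
    using assms[of i] by auto
  then have "M *v f = (\<Sum>i\<in>UNIV. c *\<^sub>R l2_inner \<pi> f (e i) *\<^sub>R e i)"
    unfolding mult_expansion scaleR_scaleR by (simp only:)
  also have "\<dots> = c *\<^sub>R f"
    by (simp only: scaleR_sum_right[symmetric] expansion[of f, symmetric])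
  finally show ?thesis .
qed

text \<open>The change of basis makes \<open>M\<close> similar to the diagonal matrix of
  \<open>d\<close>, so root multiplicities count indices.\<close>

lemma eigvals_eq: "eigvals M = rev (sorted_list_of_multiset (image_mset d (mset_set UNIV)))"
proof -
  have "M ** basis_matrix = basis_matrix ** (\<chi> i j. if i = j then d i else 0)"
    using eigen by (simp add: basis_matrix_def matrix_matrix_mult_def matrix_vector_mult_def vec_eq_iff
        if_distrib if_distribR mult.commute cong: if_cong)
  moreover have "det basis_matrix \<noteq> 0"
    using coord_basis by (metis det_I det_mul mult_zero_right zero_neq_one)
  ultimately show ?thesis
    by (simp add: eigvals_def charpoly_similar proots_charpoly_diagonal)
qed

lemma eigval_CARD: "eigval CARD('x) M = Min (range d)"
proof -
  define L where "L = sorted_list_of_multiset (image_mset d (mset_set UNIV))"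
  have "length L = CARD('x)"
    by (metis L_def mset_sorted_list_of_multiset size_image_mset size_mset size_mset_set)
  moreover from this have "L \<noteq> []"
    by auto
  \<comment> \<open>Index \<open>CARD('x) - 1\<close> of the reversed list is index 0 of the
    increasing one.\<close>
  ultimately have "eigval CARD('x) M = hd L"
    unfolding eigval_def eigvals_eq L_def[symmetric] by (simp add: rev_nth hd_conv_nth)
  also have "\<dots> = Min (range d)"
    unfolding L_def by (subst hd_sorted_list_of_multiset) (auto simp: mset_set_empty_iff)
  finally show ?thesis .
qed

text \<open>Only one index of a top eigenvalue is removed; if that eigenvalue is repeated, another
  index keeps it among the rest.\<close>

lemma eigval_2:
  assumes "\<And>i. d i \<le> d k" "CARD('x) \<ge> 2"
  shows "eigval 2 M = Max (d ` (UNIV - {k}))" "UNIV - {k} \<noteq> {}"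
proof -
  define R where "R = image_mset d (mset_set (UNIV - {k}))"
  show ne: "UNIV - {k} \<noteq> {}"
    using assms(2) by (metis Diff_eq_empty_iff card.empty card_insert_le card_mono card_1_singleton_iff
        finite.emptyI finite.insertI not_less_eq_eq numeral_2_eq_2 One_nat_def)
  then have "R \<noteq> {#}"
    by (simp add: R_def mset_set_empty_iff)
  have "image_mset d (mset_set UNIV) = add_mset (d k) R"
    unfolding R_def by (metis finite UNIV_I image_mset_add_mset mset_set.remove)
  moreover have "\<forall>x\<in>set (sorted_list_of_multiset R). x \<le> d k"
    using assms(1) by (auto simp: R_def)
  \<comment> \<open>Since \<open>d k\<close> bounds \<open>R\<close>, sorting puts it last and
    reversal puts it first; list position 1 is then the largest element of \<open>R\<close>.\<close>
  ultimately have "eigvals M = d k # rev (sorted_list_of_multiset R)"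
    by (simp add: eigvals_eq sorted_insort_is_snoc)
  moreover have "sorted_list_of_multiset R \<noteq> []"
    using \<open>R \<noteq> {#}\<close> by (metis mset.simps(1) mset_sorted_list_of_multiset)
  ultimately have "eigval 2 M = last (sorted_list_of_multiset R)"
    by (simp add: eigval_def hd_conv_nth[symmetric] hd_rev)
  also have "\<dots> = Max (d ` (UNIV - {k}))"
    using \<open>R \<noteq> {#}\<close> by (simp add: last_sorted_list_of_multiset) (simp add: R_def)
  finally show "eigval 2 M = Max (d ` (UNIV - {k}))" .
qed

end

text \<open>The symmetric spectral theorem is transported to the weighted space. With the constant
  function as basis vector \<open>k\<close>, orthogonality to constants means that coordinate
  \<open>k\<close> vanishes.\<close>

lemma self_adjoint_eigenbasis:
  fixes M :: "real^'x^'x::finite"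
  assumes full: "set_pmf \<pi> = UNIV" and adj: "l2_adjoint \<pi> M = M" and M1: "M *v 1 = a *\<^sub>R 1"
  obtains e :: "'x \<Rightarrow> real^'x" and d k where
    "orthonormal_eigenbasis \<pi> M e d" "e k = 1" "d k = a"
proof -
  define s where "s x = sqrt (pmf \<pi> x)" for x
  have s: "s x > 0" "s x * s x = pmf \<pi> x" for x
    using full by (auto simp: s_def pmf_positive)
  \<comment> \<open>Conjugation by \<open>diag s\<close> turns the \<open>\<pi>\<close>-weighted inner product into the standard one.\<close>
  define A where "A = (\<chi> x y. s x * M $ x $ y / s y)"
  \<comment> \<open>The image of the constant function; it has norm 1 because the weights sum to
    1.\<close>
  define u where "u = (\<chi> x. s x)"
  have "s x * M $ x $ y / s y = s y * M $ y $ x / s x" for x y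
  proof -
    have "M $ x $ y = pmf \<pi> y / pmf \<pi> x * M $ y $ x"
      using adj by (metis (no_types, lifting) l2_adjoint_def vec_lambda_beta)
    then show ?thesis
      using s(1)[of x] s(1)[of y] by (simp add: s(2)[symmetric] field_simps)
  qed
  then have "transpose A = A"
    by (simp add: A_def transpose_def vec_eq_iff)
  then have sym: "(A *v x) \<bullet> y = x \<bullet> (A *v y)" for x y
    by (metis dot_lmul_matrix transpose_matrix_vector)
  have conj: "(A *v f) $ x = s x * (M *v (\<chi> y. f $ y / s y)) $ x" for f x
    by (simp add: A_def matrix_vector_mult_def sum_distrib_left mult.assoc)
  have "norm u = 1"
    by (simp add: norm_eq_1 inner_vec_def u_def s sum_pmf_eq_1)
  moreover have "A *v u = a *\<^sub>R u"
  proof -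
    have "(\<chi> y. u $ y / s y) = 1"
      using s(1) by (auto simp: u_def vec_eq_iff less_imp_neq[THEN not_sym])
    then have "(A *v u) $ x = (a *\<^sub>R u) $ x" for x
      by (simp only: conj M1) (simp add: u_def)
    then show ?thesis
      by (simp add: vec_eq_iff)
  qed
  ultimately obtain B where B: "u \<in> B" "pairwise orthogonal B" "finite B" "card B = DIM(real^'x)"
      "\<And>b. b \<in> B \<Longrightarrow> norm b = 1 \<and> (\<exists>c. A *v b = c *\<^sub>R b)"
    using symmetric_orthonormal_eigenbasis_containing[OF matrix_vector_mul_linear sym] by blast
  then obtain h :: "'x \<Rightarrow> real^'x" where h: "bij_betw h UNIV B"
    using finite_same_card_bij[of "UNIV :: 'x set" B] by auto
  have "\<forall>i. \<exists>c. A *v h i = c *\<^sub>R h i"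
    using B(5) h by (simp add: bij_betwE)
  then obtain d where d: "A *v h i = d i *\<^sub>R h i" for i
    by metis
  obtain k where k: "h k = u"
    using h B(1) by (metis bij_betw_iff_bijections)
  \<comment> \<open>Dividing by \<open>s\<close> undoes the conjugation.\<close>
  define e where "e i = (\<chi> x. h i $ x / s x)" for i
  have "orthonormal_eigenbasis \<pi> M e d"
  proof
    fix i j
    have "l2_inner \<pi> (e i) (e j) = h i \<bullet> h j"
      using s(1) by (auto simp: l2_inner_def e_def inner_vec_def s(2)[symmetric]
          less_imp_neq[THEN not_sym] intro!: sum.cong)
    also have "\<dots> = (if i = j then 1 else 0)"
    proof (cases "i = j")
      case True
      then show ?thesis using B(5)[of "h i"] h by (auto simp: bij_betwE norm_eq_1)
    next
      case False
      then have "h i \<noteq> h j" "h i \<in> B" "h j \<in> B"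
        using h by (auto simp: bij_betw_def inj_def)
      then show ?thesis using B(2) False by (auto simp: pairwise_def orthogonal_def)
    qed
    finally show "l2_inner \<pi> (e i) (e j) = (if i = j then 1 else 0)" .
  next
    fix i
    have "s x * (M *v e i) $ x = s x * (d i *\<^sub>R e i) $ x" for x
      using conj[of "h i" x] s(1)[of x] by (simp add: e_def d)
    then show "M *v e i = d i *\<^sub>R e i"
      using s(1) by (metis (no_types, lifting) less_irrefl mult_left_cancel vec_eq_iff)
  qed
  moreover have "e k = 1"
    using s(1) by (auto simp: e_def k u_def vec_eq_iff less_imp_neq[THEN not_sym])
  moreover have "d k = a"
  proof -
    have "d k *\<^sub>R u = a *\<^sub>R u"
      using d[of k] k \<open>A *v u = a *\<^sub>R u\<close> by metis
    then show ?thesis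
      using \<open>norm u = 1\<close> by (metis norm_zero scaleR_cancel_right zero_neq_one)
  qed
  ultimately show ?thesis
    by (rule that)
qed

section \<open>Rayleigh quotients of reversible transition matrices\<close>

text \<open>Maximum principle: at a point where the modulus of \<open>f\<close> is largest,
  \<open>c * f $ x\<close> is an average of values of \<open>f\<close>.\<close>

lemma transition_matrix_eigenvalue_le_1:
  fixes M :: "real^'x^'x::finite"
  assumes M: "M \<in> transition_matrices" and f: "M *v f = c *\<^sub>R f" "f \<noteq> 0"
  shows "c \<le> 1"
proof -
  define m where "m = Max (range (\<lambda>x. \<bar>f $ x\<bar>))"
  have m: "\<bar>f $ y\<bar> \<le> m" for y
    by (simp add: m_def)
  have "m \<in> range (\<lambda>x. \<bar>f $ x\<bar>)"
    unfolding m_def by (rule Max_in) auto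
  then obtain x where x: "m = \<bar>f $ x\<bar>"
    by blast
  obtain z where "f $ z \<noteq> 0"
    using f(2) by (auto simp: vec_eq_iff)
  then have "m > 0"
    using m[of z] by linarith
  have "c * m \<le> \<bar>c * f $ x\<bar>"
    by (simp add: x abs_mult mult_right_mono)
  also have "c * f $ x = (\<Sum>y\<in>UNIV. M $ x $ y * f $ y)"
    using f(1) by (simp add: vec_eq_iff matrix_vector_mult_def)
  also have "\<bar>\<dots>\<bar> \<le> (\<Sum>y\<in>UNIV. M $ x $ y * m)"
    using M m by (intro order.trans[OF sum_abs] sum_mono)
      (simp add: abs_mult transition_matrices_def mult_left_mono)
  also have "\<dots> = m"
    using M by (simp add: sum_distrib_right[symmetric] transition_matrices_def)
  finally show ?thesis
    using \<open>m > 0\<close> by simp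
qed

lemma transition_matrices_iff_mult_1:
  "M \<in> transition_matrices \<longleftrightarrow> (\<forall>x y. 0 \<le> M $ x $ y) \<and> M *v 1 = 1"
  by (simp add: transition_matrices_def matrix_vector_mult_def vec_eq_iff)

context
  fixes \<pi> :: "'x::finite pmf" and M :: "real^'x^'x"
  assumes full: "set_pmf \<pi> = UNIV" and M: "M \<in> reversible_transition_matrices \<pi>"
begin

text \<open>The constant function has eigenvalue 1, which no eigenvalue exceeds, so its index can
  serve as \<open>k\<close> in \<open>eigval_2\<close>.\<close>

lemma obtain_stochastic_eigenbasis:
  obtains e d k where "orthonormal_eigenbasis \<pi> M e d" "e k = 1" "\<And>i. d i \<le> d k"
proof -
  have T: "M \<in> transition_matrices" and adj: "l2_adjoint \<pi> M = M"
    using M reversible_transition_matrices_iff[OF full] by blast+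
  from T have M1: "M *v 1 = 1 *\<^sub>R 1"
    by (simp add: transition_matrices_iff_mult_1)
  obtain e d k where e: "orthonormal_eigenbasis \<pi> M e d" "e k = 1" "d k = 1"
    by (rule self_adjoint_eigenbasis[OF full adj M1])
  interpret orthonormal_eigenbasis \<pi> M e d by fact
  have "d i \<le> d k" for i
  proof -
    have "e i \<noteq> 0"
      using orthonormal[of i i] by (auto simp: l2_inner_def)
    then show ?thesis
      using transition_matrix_eigenvalue_le_1[OF T eigen] e(3) by simp
  qed
  then show ?thesis
    by (rule that[OF e(1,2)])
qed

text \<open>Orthogonally to constants, coordinate \<open>k\<close> disappears and every other
  \<open>d i\<close> is at most the second eigenvalue. All terms of the shifted form are then
  nonnegative, and equality makes each one zero.\<close>

lemma eigval_2_rayleigh: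
  assumes n: "CARD('x) \<ge> 2"
  shows "l2_inner \<pi> f 1 = 0 \<Longrightarrow> l2_inner \<pi> (M *v f) f \<le> eigval 2 M * l2_inner \<pi> f f"
    and "l2_inner \<pi> f 1 = 0 \<Longrightarrow> l2_inner \<pi> (M *v f) f = eigval 2 M * l2_inner \<pi> f f
      \<Longrightarrow> M *v f = eigval 2 M *\<^sub>R f"
    and "\<exists>f. f \<noteq> 0 \<and> l2_inner \<pi> f 1 = 0 \<and> M *v f = eigval 2 M *\<^sub>R f"
    and "eigval CARD('x) M \<le> eigval 2 M"
proof -
  obtain e d k where e: "orthonormal_eigenbasis \<pi> M e d" "e k = 1" "\<And>i. d i \<le> d k"
    using obtain_stochastic_eigenbasis by blast
  interpret orthonormal_eigenbasis \<pi> M e d by fact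
  define c where "c = eigval 2 M"
  note c = eigval_2[OF e(3) n, folded c_def]
  have d_le: "d i \<le> c" if "i \<noteq> k" for i
    using that by (simp add: c)
  \<comment> \<open>For \<open>i = k\<close> the factor \<open>c - d k\<close> may be negative, but
    the coefficient is zero because \<open>e k = 1\<close>.\<close>
  have nonneg: "0 \<le> (c - d i) * (l2_inner \<pi> f (e i))\<^sup>2" if "l2_inner \<pi> f 1 = 0" for f i
    using that d_le[of i] e(2) by (cases "i = k") auto
  {
    assume f: "l2_inner \<pi> f 1 = 0"
    then show "l2_inner \<pi> (M *v f) f \<le> eigval 2 M * l2_inner \<pi> f f"
      using sum_nonneg[of UNIV "\<lambda>i. (c - d i) * (l2_inner \<pi> f (e i))\<^sup>2"] nonneg[OF f]
        quadratic_form_shift[of c f] by (simp add: c_def)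
    assume "l2_inner \<pi> (M *v f) f = eigval 2 M * l2_inner \<pi> f f"
    then have "(\<Sum>i\<in>UNIV. (c - d i) * (l2_inner \<pi> f (e i))\<^sup>2) = 0"
      using quadratic_form_shift[of c f] by (simp add: c_def)
    then have "(c - d i) * (l2_inner \<pi> f (e i))\<^sup>2 = 0" for i
      using nonneg[OF f] by (subst (asm) sum_nonneg_eq_0_iff) auto
    then show "M *v f = eigval 2 M *\<^sub>R f"
      unfolding c_def by (rule eigenvectorI_coords)
  }
  \<comment> \<open>The maximum is attained at an index other than \<open>k\<close>, so the
    eigenvector found is orthogonal to constants even if its eigenvalue is 1.\<close>
  have "c \<in> d ` (UNIV - {k})"
    unfolding c(1) using c(2) by (intro Max_in) auto
  then obtain j where j: "j \<noteq> k" "c = d j"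
    by blast
  have "e j \<noteq> 0"
    using orthonormal[of j j] by (auto simp: l2_inner_def)
  then show "\<exists>f. f \<noteq> 0 \<and> l2_inner \<pi> f 1 = 0 \<and> M *v f = eigval 2 M *\<^sub>R f"
    using j eigen[of j] orthonormal[of j k] e(2) c_def by metis
  show "eigval CARD('x) M \<le> eigval 2 M"
    using j unfolding eigval_CARD c_def[symmetric] by simp
qed

text \<open>Now \<open>c\<close> is the least \<open>d i\<close>, so every term of the shifted form
  is nonpositive for arbitrary \<open>f\<close>.\<close>

lemma eigval_CARD_rayleigh:
  shows "eigval CARD('x) M * l2_inner \<pi> f f \<le> l2_inner \<pi> (M *v f) f"
    and "l2_inner \<pi> (M *v f) f = eigval CARD('x) M * l2_inner \<pi> f f
      \<Longrightarrow> M *v f = eigval CARD('x) M *\<^sub>R f"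
    and "\<exists>f. f \<noteq> 0 \<and> M *v f = eigval CARD('x) M *\<^sub>R f"
proof -
  obtain e d k where e: "orthonormal_eigenbasis \<pi> M e d"
    using obtain_stochastic_eigenbasis by blast
  interpret orthonormal_eigenbasis \<pi> M e d by fact
  define c where "c = eigval CARD('x) M"
  have nonpos: "(c - d i) * (l2_inner \<pi> f (e i))\<^sup>2 \<le> 0" for f i
    by (simp add: mult_nonpos_nonneg c_def eigval_CARD)
  show "eigval CARD('x) M * l2_inner \<pi> f f \<le> l2_inner \<pi> (M *v f) f"
    using sum_nonpos[of UNIV "\<lambda>i. (c - d i) * (l2_inner \<pi> f (e i))\<^sup>2"] nonpos[of _ f]
      quadratic_form_shift[of c f] by (simp add: c_def)
  {
    assume "l2_inner \<pi> (M *v f) f = eigval CARD('x) M * l2_inner \<pi> f f"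
    then have "(\<Sum>i\<in>UNIV. - ((c - d i) * (l2_inner \<pi> f (e i))\<^sup>2)) = 0"
      using quadratic_form_shift[of c f] by (simp add: c_def sum_negf)
    then have "(c - d i) * (l2_inner \<pi> f (e i))\<^sup>2 = 0" for i
      using nonpos[of _ f] by (subst (asm) sum_nonneg_eq_0_iff) auto
    then show "M *v f = eigval CARD('x) M *\<^sub>R f"
      unfolding c_def by (rule eigenvectorI_coords)
  }
  have "c \<in> range d"
    unfolding c_def eigval_CARD by (intro Min_in) auto
  then obtain j where "c = d j"
    by blast
  moreover have "e j \<noteq> 0"
    using orthonormal[of j j] by (auto simp: l2_inner_def)
  ultimately show "\<exists>f. f \<noteq> 0 \<and> M *v f = eigval CARD('x) M *\<^sub>R f"
    using eigen[of j] c_def by metis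
qed

end

section \<open>Conjugation by the involution and convex combinations\<close>

text \<open>Adjoints reverse products, so the palindrome \<open>Q ** P ** Q\<close> is self-adjoint;
  products of transition matrices stay nonnegative and fix the constant function.\<close>

lemma reversible_QPQ:
  assumes full: "set_pmf \<pi> = UNIV" and P: "P \<in> reversible_transition_matrices \<pi>"
    and Q: "Q \<in> reversible_transition_matrices \<pi>"
  shows "Q ** P ** Q \<in> reversible_transition_matrices \<pi>"
proof -
  have adj_mult: "l2_adjoint \<pi> (A ** B) = l2_adjoint \<pi> B ** l2_adjoint \<pi> A" for A B
  proof -
    have "pmf \<pi> x \<noteq> 0" for x
      using full by (simp add: set_pmf_iff[symmetric])
    then show ?thesis
      by (simp add: l2_adjoint_def matrix_matrix_mult_def vec_eq_iff sum_distrib_left mult_ac)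
  qed
  have "l2_adjoint \<pi> P = P" "l2_adjoint \<pi> Q = Q" and T: "P \<in> transition_matrices" "Q \<in> transition_matrices"
    using P Q reversible_transition_matrices_iff[OF full] by blast+
  then have "l2_adjoint \<pi> (Q ** P ** Q) = Q ** P ** Q"
    by (simp add: adj_mult matrix_mul_assoc)
  moreover have "Q ** P ** Q \<in> transition_matrices"
    using T by (auto simp: transition_matrices_iff_mult_1 matrix_vector_mul_assoc[symmetric])
      (auto simp: matrix_matrix_mult_def intro!: sum_nonneg mult_nonneg_nonneg)
  ultimately show ?thesis
    using reversible_transition_matrices_iff[OF full] by blast
qed

lemma reversible_convex_combination:
  assumes "A \<in> reversible_transition_matrices \<pi>" "B \<in> reversible_transition_matrices \<pi>"
    and "0 \<le> \<alpha>" "\<alpha> \<le> 1"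
  shows "\<alpha> *\<^sub>R A + (1 - \<alpha>) *\<^sub>R B \<in> reversible_transition_matrices \<pi>"
proof -
  have AB: "A \<in> transition_matrices" "B \<in> transition_matrices"
    and rev: "pmf \<pi> x * A $ x $ y = pmf \<pi> y * A $ y $ x" "pmf \<pi> x * B $ x $ y = pmf \<pi> y * B $ y $ x" for x y
    using assms by (simp_all add: reversible_transition_matrices_def)
  have "\<alpha> *\<^sub>R A + (1 - \<alpha>) *\<^sub>R B \<in> transition_matrices"
    using AB assms(3,4) by (simp add: transition_matrices_def sum.distrib sum_distrib_left[symmetric])
  moreover have "pmf \<pi> x * (\<alpha> * A $ x $ y + (1 - \<alpha>) * B $ x $ y) =
      pmf \<pi> y * (\<alpha> * A $ y $ x + (1 - \<alpha>) * B $ y $ x)" for x y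
    by (simp only: distrib_left mult.left_commute[of "pmf _ _"] rev[of x y])
  ultimately show ?thesis
    by (simp add: reversible_transition_matrices_def)
qed

text \<open>\<open>Q\<close> is its own inverse, so this is a similarity; \<open>det Q\<close>
  squares to 1.\<close>

lemma eigval_QPQ:
  fixes P Q :: "real^'x^'x::finite"
  assumes "Q ** Q = mat 1"
  shows "eigval k (Q ** P ** Q) = eigval k P"
proof (rule eigval_similar)
  show "(Q ** P ** Q) ** Q = Q ** P"
    by (simp add: matrix_mul_assoc[symmetric] assms)
  show "det Q \<noteq> 0"
    using assms by (metis det_I det_mul mult_zero_right zero_neq_one)
qed

theorem proposition3p5:
  fixes \<pi> :: "'x::finite pmf" and P Q :: "real^'x^'x" and \<alpha> :: real
  assumes "CARD('x) \<ge> 2"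
    and "set_pmf \<pi> = UNIV"
    and "P \<in> reversible_transition_matrices \<pi>"
    and "Q \<in> isometric_involutions \<pi> \<inter> transition_matrices"
    and "0 < \<alpha>" and "\<alpha> < 1"
  shows
    "eigval 2 (P_bar \<alpha> P Q) \<le> eigval 2 P
     \<and> (eigval 2 (P_bar \<alpha> P Q) = eigval 2 P \<longleftrightarrow>
          (\<exists>f. eigenvector (P_bar \<alpha> P Q) (eigval 2 (P_bar \<alpha> P Q)) f
             \<and> eigenvector P (eigval 2 P) f
             \<and> eigenvector (Q ** P ** Q) (eigval 2 (Q ** P ** Q)) f))
     \<and> eigval CARD('x) P \<le> eigval CARD('x) (P_bar \<alpha> P Q)
     \<and> (eigval CARD('x) P = eigval CARD('x) (P_bar \<alpha> P Q) \<longleftrightarrow>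
          (\<exists>g. eigenvector (P_bar \<alpha> P Q) (eigval CARD('x) (P_bar \<alpha> P Q)) g
             \<and> eigenvector P (eigval CARD('x) P) g
             \<and> eigenvector (Q ** P ** Q) (eigval CARD('x) (Q ** P ** Q)) g))
     \<and> SLEM (P_bar \<alpha> P Q) \<le> SLEM P
     \<and> (l2_pos_semidef \<pi> P \<longrightarrow>
          l2_pos_semidef \<pi> (Q ** P ** Q)
          \<and> max \<alpha> (1 - \<alpha>) * eigval 2 P \<le> eigval 2 (P_bar \<alpha> P Q)
          \<and> eigval 2 (P_bar \<alpha> P Q) \<le> eigval 2 P
          \<and> max \<alpha> (1 - \<alpha>) * SLEM P \<le> SLEM (P_bar \<alpha> P Q)
          \<and> SLEM (P_bar \<alpha> P Q) \<le> SLEM P)"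
proof -
  define B where "B = Q ** P ** Q"
  define C where "C = P_bar \<alpha> P Q"
  have Q: "Q ** Q = mat 1" "l2_adjoint \<pi> Q = Q" "Q \<in> reversible_transition_matrices \<pi>"
    using assms(4) by (auto simp: isometric_involutions_def reversible_transition_matrices_iff[OF assms(2)])
  have C_eq: "C = \<alpha> *\<^sub>R P + (1 - \<alpha>) *\<^sub>R B"
    by (simp add: C_def B_def P_bar_def)
  have Brev: "B \<in> reversible_transition_matrices \<pi>"
    unfolding B_def by (rule reversible_QPQ[OF assms(2,3) Q(3)])
  have Crev: "C \<in> reversible_transition_matrices \<pi>"
    unfolding C_eq using assms Brev by (intro reversible_convex_combination) auto
  have C_mult: "C *v f = \<alpha> *\<^sub>R (P *v f) + (1 - \<alpha>) *\<^sub>R (B *v f)" for f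
    by (simp add: C_eq matrix_vector_mult_add_rdistrib scaleR_matrix_vector_assoc)
  have C_form: "l2_inner \<pi> (C *v f) f = \<alpha> * l2_inner \<pi> (P *v f) f + (1 - \<alpha>) * l2_inner \<pi> (B *v f) f" for f
    by (simp add: C_mult l2_inner_add_left l2_inner_scaleR_left)
  have eB: "eigval k B = eigval k P" for k
    unfolding B_def by (rule eigval_QPQ[OF Q(1)])
  have split: "\<alpha> * z + (1 - \<alpha>) * z = z" for z
    by (simp add: algebra_simps)
  note pos = l2_inner_pos[OF assms(2)]
  \<comment> \<open>Rewriting with \<open>eB\<close> gives \<open>P\<close> and \<open>B\<close> the
    same bounds.\<close>
  note P2 = eigval_2_rayleigh[OF assms(2,3,1)] and B2 = eigval_2_rayleigh[OF assms(2) Brev assms(1), unfolded eB]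
    and C2 = eigval_2_rayleigh[OF assms(2) Crev assms(1)]
  note Pn = eigval_CARD_rayleigh[OF assms(2,3)] and Bn = eigval_CARD_rayleigh[OF assms(2) Brev, unfolded eB]
    and Cn = eigval_CARD_rayleigh[OF assms(2) Crev]

  \<comment> \<open>The second eigenvalue\<close>
  \<comment> \<open>At this eigenvector the form of \<open>C\<close> equals its second eigenvalue
    times the squared norm of \<open>f\<close>; orthogonality to constants makes the Rayleigh bounds
    for \<open>P\<close> and \<open>B\<close> available.\<close>
  obtain f where f: "f \<noteq> 0" "l2_inner \<pi> f 1 = 0" "C *v f = eigval 2 C *\<^sub>R f"
    using C2(3) by blast
  have f_form: "eigval 2 C * l2_inner \<pi> f f = \<alpha> * l2_inner \<pi> (P *v f) f + (1 - \<alpha>) * l2_inner \<pi> (B *v f) f"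
    using C_form[of f] by (simp add: f l2_inner_scaleR_left)
  have fP: "\<alpha> * l2_inner \<pi> (P *v f) f \<le> \<alpha> * (eigval 2 P * l2_inner \<pi> f f)"
    and fB: "(1 - \<alpha>) * l2_inner \<pi> (B *v f) f \<le> (1 - \<alpha>) * (eigval 2 P * l2_inner \<pi> f f)"
    using assms(5,6) P2(1)[OF f(2)] B2(1)[OF f(2)] by (auto intro: mult_left_mono)
  have "eigval 2 C * l2_inner \<pi> f f \<le> eigval 2 P * l2_inner \<pi> f f"
    using fP fB f_form split[of "eigval 2 P * l2_inner \<pi> f f"] by linarith
  then have le2: "eigval 2 C \<le> eigval 2 P"
    using pos[OF f(1)] by simp
  have eq2: "eigval 2 C = eigval 2 P \<longleftrightarrow>
      (\<exists>f. eigenvector C (eigval 2 C) f \<and> eigenvector P (eigval 2 P) f \<and> eigenvector B (eigval 2 B) f)"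
  proof
    assume eq: "eigval 2 C = eigval 2 P"
    \<comment> \<open>Two inequalities whose sum is an equality are both tight. The positive weights
      cancel, and tight Rayleigh bounds make \<open>f\<close> an eigenvector.\<close>
    have "\<alpha> * l2_inner \<pi> (P *v f) f = \<alpha> * (eigval 2 P * l2_inner \<pi> f f)"
      and "(1 - \<alpha>) * l2_inner \<pi> (B *v f) f = (1 - \<alpha>) * (eigval 2 P * l2_inner \<pi> f f)"
      using fP fB f_form[unfolded eq] split[of "eigval 2 P * l2_inner \<pi> f f"] by linarith+
    then have "P *v f = eigval 2 P *\<^sub>R f" "B *v f = eigval 2 P *\<^sub>R f"
      using assms(5,6) f(2) by (auto intro: P2(2) B2(2))
    then show "\<exists>f. eigenvector C (eigval 2 C) f \<and> eigenvector P (eigval 2 P) f \<and> eigenvector B (eigval 2 B) f"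
      using f by (auto simp: eigenvector_def eB)
  next
    assume "\<exists>f. eigenvector C (eigval 2 C) f \<and> eigenvector P (eigval 2 P) f \<and> eigenvector B (eigval 2 B) f"
    then obtain f where f: "f \<noteq> 0" "C *v f = eigval 2 C *\<^sub>R f" "P *v f = eigval 2 P *\<^sub>R f"
        "B *v f = eigval 2 P *\<^sub>R f"
      by (auto simp: eigenvector_def eB)
    have "C *v f = eigval 2 P *\<^sub>R f"
      unfolding C_mult f(3,4) by (simp add: algebra_simps)
    with f(1,2) show "eigval 2 C = eigval 2 P"
      by (metis scaleR_cancel_right)
  qed

  \<comment> \<open>The smallest eigenvalue\<close>
  obtain g where g: "g \<noteq> 0" "C *v g = eigval CARD('x) C *\<^sub>R g"
    using Cn(3) by blast
  have g_form: "eigval CARD('x) C * l2_inner \<pi> g g =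
      \<alpha> * l2_inner \<pi> (P *v g) g + (1 - \<alpha>) * l2_inner \<pi> (B *v g) g"
    using C_form[of g] by (simp add: g l2_inner_scaleR_left)
  have gP: "\<alpha> * (eigval CARD('x) P * l2_inner \<pi> g g) \<le> \<alpha> * l2_inner \<pi> (P *v g) g"
    and gB: "(1 - \<alpha>) * (eigval CARD('x) P * l2_inner \<pi> g g) \<le> (1 - \<alpha>) * l2_inner \<pi> (B *v g) g"
    using assms(5,6) Pn(1)[of g] Bn(1)[of g] by (auto intro: mult_left_mono)
  have "eigval CARD('x) P * l2_inner \<pi> g g \<le> eigval CARD('x) C * l2_inner \<pi> g g"
    using gP gB g_form split[of "eigval CARD('x) P * l2_inner \<pi> g g"] by linarith
  then have len: "eigval CARD('x) P \<le> eigval CARD('x) C"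
    using pos[OF g(1)] by simp
  have eqn: "eigval CARD('x) P = eigval CARD('x) C \<longleftrightarrow>
      (\<exists>g. eigenvector C (eigval CARD('x) C) g \<and> eigenvector P (eigval CARD('x) P) g
        \<and> eigenvector B (eigval CARD('x) B) g)"
  proof
    assume eq: "eigval CARD('x) P = eigval CARD('x) C"
    have "\<alpha> * l2_inner \<pi> (P *v g) g = \<alpha> * (eigval CARD('x) P * l2_inner \<pi> g g)"
      and "(1 - \<alpha>) * l2_inner \<pi> (B *v g) g = (1 - \<alpha>) * (eigval CARD('x) P * l2_inner \<pi> g g)"
      using gP gB g_form[folded eq] split[of "eigval CARD('x) P * l2_inner \<pi> g g"] by linarith+
    then have "P *v g = eigval CARD('x) P *\<^sub>R g" "B *v g = eigval CARD('x) P *\<^sub>R g"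
      using assms(5,6) by (auto intro: Pn(2) Bn(2))
    then show "\<exists>g. eigenvector C (eigval CARD('x) C) g \<and> eigenvector P (eigval CARD('x) P) g
        \<and> eigenvector B (eigval CARD('x) B) g"
      using g by (auto simp: eigenvector_def eB)
  next
    assume "\<exists>g. eigenvector C (eigval CARD('x) C) g \<and> eigenvector P (eigval CARD('x) P) g
        \<and> eigenvector B (eigval CARD('x) B) g"
    then obtain g where g: "g \<noteq> 0" "C *v g = eigval CARD('x) C *\<^sub>R g"
        "P *v g = eigval CARD('x) P *\<^sub>R g" "B *v g = eigval CARD('x) P *\<^sub>R g"
      by (auto simp: eigenvector_def eB)
    have "C *v g = eigval CARD('x) P *\<^sub>R g"
      unfolding C_mult g(3,4) by (simp add: algebra_simps)
    with g(1,2) show "eigval CARD('x) P = eigval CARD('x) C"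
      by (metis scaleR_cancel_right)
  qed

  \<comment> \<open>SLEM and the positive semidefinite case\<close>
  \<comment> \<open>If the least eigenvalue of \<open>C\<close> is negative, its modulus is at most
    that of the least eigenvalue of \<open>P\<close>; otherwise it is at most
    \<open>eigval 2 C\<close>, hence at most \<open>eigval 2 P\<close>.\<close>
  have slem: "SLEM C \<le> SLEM P"
    using le2 len C2(4) unfolding SLEM_def by linarith

  have psd: "l2_pos_semidef \<pi> B \<and> max \<alpha> (1 - \<alpha>) * eigval 2 P \<le> eigval 2 C
      \<and> max \<alpha> (1 - \<alpha>) * SLEM P \<le> SLEM C"
    if P: "l2_pos_semidef \<pi> P"
  proof -
    have P0: "0 \<le> l2_inner \<pi> (P *v h) h" for h
      using P by (simp add: l2_pos_semidef_def)
    have B0: "0 \<le> l2_inner \<pi> (B *v h) h" for h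
    proof -
      \<comment> \<open>Self-adjointness of \<open>Q\<close> moves the left factor across: the form
        of \<open>B\<close> at \<open>h\<close> is that of \<open>P\<close> at
        \<open>Q *v h\<close>.\<close>
      have "l2_inner \<pi> (B *v h) h = l2_inner \<pi> (P *v (Q *v h)) (Q *v h)"
        using l2_inner_adjoint[OF assms(2), of Q "P *v (Q *v h)" h]
        by (simp add: B_def Q(2) matrix_vector_mul_assoc matrix_mul_assoc)
      then show ?thesis
        using P0 by simp
    qed
    have "l2_pos_semidef \<pi> B"
      using B0 Brev by (simp add: l2_pos_semidef_def reversible_transition_matrices_iff[OF assms(2)])
    moreover have 2: "max \<alpha> (1 - \<alpha>) * eigval 2 P \<le> eigval 2 C"
    proof -
      \<comment> \<open>Testing \<open>C\<close> on a second eigenvector of \<open>P\<close> and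
        dropping the nonnegative \<open>B\<close> term gives the factor \<open>\<alpha>\<close>;
        below, an eigenvector of \<open>B\<close> gives \<open>1 - \<alpha>\<close>.\<close>
      obtain h where h: "h \<noteq> 0" "l2_inner \<pi> h 1 = 0" "P *v h = eigval 2 P *\<^sub>R h"
        using P2(3) by blast
      have "\<alpha> * eigval 2 P * l2_inner \<pi> h h \<le> l2_inner \<pi> (C *v h) h"
        using B0[of h] assms(6) by (simp add: C_form h l2_inner_scaleR_left)
      also have "\<dots> \<le> eigval 2 C * l2_inner \<pi> h h"
        by (rule C2(1)[OF h(2)])
      finally have 1: "\<alpha> * eigval 2 P \<le> eigval 2 C"
        using pos[OF h(1)] by simp
      obtain h where h: "h \<noteq> 0" "l2_inner \<pi> h 1 = 0" "B *v h = eigval 2 P *\<^sub>R h"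
        using B2(3) by blast
      have "(1 - \<alpha>) * eigval 2 P * l2_inner \<pi> h h \<le> l2_inner \<pi> (C *v h) h"
        using P0[of h] assms(5) by (simp add: C_form h l2_inner_scaleR_left)
      also have "\<dots> \<le> eigval 2 C * l2_inner \<pi> h h"
        by (rule C2(1)[OF h(2)])
      finally have "(1 - \<alpha>) * eigval 2 P \<le> eigval 2 C"
        using pos[OF h(1)] by simp
      with 1 show ?thesis
        by (simp add: max_def)
    qed
    \<comment> \<open>The least eigenvalue of \<open>P\<close>, and hence that of \<open>C\<close>,
      is nonnegative, so its modulus is at most the second eigenvalue.\<close>
    moreover have "SLEM P = eigval 2 P" "SLEM C = eigval 2 C"
    proof -
      obtain h where h: "h \<noteq> 0" "P *v h = eigval CARD('x) P *\<^sub>R h"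
        using Pn(3) by blast
      have "0 \<le> eigval CARD('x) P * l2_inner \<pi> h h"
        using P0[of h] by (simp add: h l2_inner_scaleR_left)
      then have "0 \<le> eigval CARD('x) P"
        using pos[OF h(1)] by (simp add: zero_le_mult_iff)
      then show "SLEM P = eigval 2 P" "SLEM C = eigval 2 C"
        using len P2(4) C2(4) by (auto simp: SLEM_def)
    qed
    ultimately show ?thesis
      by simp
  qed
  show ?thesis
    using le2 eq2 len eqn slem psd unfolding B_def C_def by blast
qed

end
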